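(* Let $\mathcal{L}$ be a quasi-definite linear functional with monic orthogonal polynomials $\{P_n\}_{n\ge0}$. Let $a_1,a_2\in\mathbb{R}$, let the Geronimus transformation of $\mathcal{L}$ at $a_1$ be quasi-definite with monic orthogonal polynomials $\mathcal{G}_n(x;a_1)$, let $(\beta_n)_{n\ge1}$ be complex numbers, and let $\mathcal{G}_n^Q(x;a_1)=\mathcal{G}_n(x;a_1)+\beta_n\mathcal{G}_{n-1}(x;a_1)$, $n\ge1$, be the monic quasi-Geronimus polynomials of order one. Let the Christoffel transformation of $\mathcal{L}$ at $a_2$ be quasi-definite, with monic orthogonal (kernel) polynomials $\mathcal{C}_n(x;a_2)$, $n\ge0$, and put $\mathcal{C}_{-1}=0$. Then there exist sequences of complex numbers $\{\gamma_n\}_{n\ge0}$ and $\{\eta_n\}_{n\ge0}$ such that, as an identity of rational functions in $x$, $$P_n(x)=\frac{1}{x-\eta_n}\mathcal{G}_{n+1}^Q(x;a_1)+\frac{\gamma_n(x-a_2)}{x-\eta_n}\mathcal{C}_{n-1}(x;a_2),\qquad n\ge0.$$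
   Context: A linear functional $\mathcal{L}$ on $\mathbb{C}[x]$ is quasi-definite if there is a (unique) sequence of monic polynomials $P_n$, $\deg P_n=n$, with $\mathcal{L}[P_nP_m]=0$ for $n\ne m$ and $\mathcal{L}[P_n^2]\neq0$; these are its monic orthogonal polynomials. Geronimus transformation at $a_1$ with constant $M$: $\mathcal{L}^G[p(x)]=\mathcal{L}\left[\frac{p(x)-p(a_1)}{x-a_1}\right]+Mp(a_1)$. When it is quasi-definite, its monic orthogonal polynomials satisfy $\mathcal{G}_0=1$ and $\mathcal{G}_n(x;a_1)=P_n(x)+\chi_n(a_1)P_{n-1}(x)$ for $n\ge1$, where $\chi_n(a_1)=-\mathcal{L}^G[P_n]/\mathcal{L}^G[P_{n-1}]$ is well defined and nonzero. Christoffel transformation at $a_2$: $\mathcal{L}^C[p(x)]=\mathcal{L}[(x-a_2)p(x)]$. It is quasi-definite if and only if $P_n(a_2)\ne0$ for all $n\ge1$, and then its monic orthogonal polynomials are $\mathcal{C}_n(x;a_2)=\frac{1}{x-a_2}\left[P_{n+1}(x)-\frac{P_{n+1}(a_2)}{P_n(a_2)}P_n(x)\right]$, $n\ge0$. *)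

theory Defs
  imports Complex_Main "HOL-Computational_Algebra.Computational_Algebra"
begin

abbreviation linear_functional :: "(complex poly \<Rightarrow> complex) \<Rightarrow> bool" where
  "linear_functional L \<equiv> Vector_Spaces.linear smult (*) L"

definition monic_ops :: "(complex poly \<Rightarrow> complex) \<Rightarrow> (nat \<Rightarrow> complex poly) \<Rightarrow> bool" where
  "monic_ops L P \<longleftrightarrow>
     (\<forall>n. degree (P n) = n \<and> lead_coeff (P n) = 1) \<and>
     (\<forall>n m. n \<noteq> m \<longrightarrow> L (P n * P m) = 0) \<and>
     (\<forall>n. L (P n ^ 2) \<noteq> 0)"

definition quasi_definite :: "(complex poly \<Rightarrow> complex) \<Rightarrow> bool" where
  "quasi_definite L \<longleftrightarrow> (\<exists>P. monic_ops L P)"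

text \<open>The division in the next definition is exact, since \<open>p - p(a)\<close> vanishes at \<open>a\<close>.\<close>

definition geronimus ::
    "complex \<Rightarrow> complex \<Rightarrow> (complex poly \<Rightarrow> complex) \<Rightarrow> complex poly \<Rightarrow> complex" where
  "geronimus a M L p = L ((p - [:poly p a:]) div [:-a, 1:]) + M * poly p a"

definition christoffel ::
    "complex \<Rightarrow> (complex poly \<Rightarrow> complex) \<Rightarrow> complex poly \<Rightarrow> complex" where
  "christoffel a L p = L ([:-a, 1:] * p)"

text \<open>Only meaningful for \<open>n \<ge> 1\<close>; at \<open>n = 0\<close> natural subtraction makes the value junk.\<close>

definition quasi_geronimus ::
    "(nat \<Rightarrow> complex) \<Rightarrow> (nat \<Rightarrow> complex poly) \<Rightarrow> nat \<Rightarrow> complex poly" where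
  "quasi_geronimus \<beta> G n = G n + smult (\<beta> n) (G (n - 1))"

text \<open>\<open>pred_term C n\<close> is \<open>C\<^sub>n\<^sub>-\<^sub>1\<close>, with the convention that \<open>C\<^sub>-\<^sub>1 = 0\<close>.\<close>

definition pred_term :: "(nat \<Rightarrow> complex poly) \<Rightarrow> nat \<Rightarrow> complex poly" where
  "pred_term C n = (case n of 0 \<Rightarrow> 0 | Suc m \<Rightarrow> C m)"

end

theory Submission imports Defs
begin

text \<open>
  Fix \<open>n \<ge> 1\<close>. Both \<open>x P\<^sub>n - G\<^sup>Q\<^sub>n\<^sub>+\<^sub>1\<close> and \<open>(x - a\<^sub>2) C\<^sub>n\<^sub>-\<^sub>1\<close> have degree at most \<open>n\<close> and are
  \<open>L\<close>-orthogonal to all polynomials of degree less than \<open>n - 1\<close>, so both lie in the span of \<open>P\<^sub>n\<close> and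
  \<open>P\<^sub>n\<^sub>-\<^sub>1\<close>. The second one has a nonzero component along \<open>P\<^sub>n\<^sub>-\<^sub>1\<close>, since otherwise
  \<open>L[(x - a\<^sub>2) C\<^sub>n\<^sub>-\<^sub>1\<^sup>2] = 0\<close>. Hence subtracting a multiple \<open>\<gamma>\<^sub>n\<close> of the second from the first leaves a
  multiple \<open>\<eta>\<^sub>n\<close> of \<open>P\<^sub>n\<close>.
\<close>

section \<open>Linear functionals and the linearity of both transformations\<close>

lemma linear_functional_add: "linear_functional L \<Longrightarrow> L (p + q) = L p + L q"
  and linear_functional_smult: "linear_functional L \<Longrightarrow> L (smult c p) = c * L p"
  by (simp_all add: Vector_Spaces.linear_iff)

lemma linear_functional_0: "linear_functional L \<Longrightarrow> L 0 = 0"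
  using linear_functional_smult[of L 0 0] by simp

lemma linear_functional_diff: "linear_functional L \<Longrightarrow> L (p - q) = L p - L q"
  using linear_functional_add[of L "p - q" q] by simp

lemma linear_functionalI:
  assumes "\<And>p q. L (p + q) = L p + L q" and "\<And>c p. L (smult c p) = c * L p"
  shows "linear_functional L"
  unfolding Vector_Spaces.linear_iff
  using assms by (auto intro!: vector_space.intro simp: algebra_simps smult_add_left smult_add_right)

lemma linear_functional_christoffel:
  assumes "linear_functional L"
  shows "linear_functional (christoffel a L)"
proof (rule linear_functionalI)
  fix p q
  show "christoffel a L (p + q) = christoffel a L p + christoffel a L q"
    unfolding christoffel_def distrib_left by (rule linear_functional_add[OF assms])
next
  fix c p
  show "christoffel a L (smult c p) = c * christoffel a L p"
    unfolding christoffel_def mult_smult_right by (rule linear_functional_smult[OF assms])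
qed

lemma linear_functional_geronimus:
  assumes "linear_functional L"
  shows "linear_functional (geronimus a M L)"
proof (rule linear_functionalI)
  fix p q
  have "p + q - [:poly (p + q) a:] = (p - [:poly p a:]) + (q - [:poly q a:])"
    by simp
  then show "geronimus a M L (p + q) = geronimus a M L p + geronimus a M L q"
    unfolding geronimus_def
    by (simp only: poly_div_add_left linear_functional_add[OF assms] poly_add distrib_left add_ac)
next
  fix c p
  have "smult c p - [:poly (smult c p) a:] = smult c (p - [:poly p a:])"
    by (simp add: smult_diff_right)
  then show "geronimus a M L (smult c p) = c * geronimus a M L p"
    unfolding geronimus_def
    by (simp only: div_smult_left linear_functional_smult[OF assms] poly_smult distrib_left
        mult.left_commute)
qed

text \<open>The Christoffel transformation at the same point undoes the Geronimus one: the product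
  vanishes at \<open>a\<close>, so the mass term drops out and the quotient is exactly
  \<open>p\<close>.\<close>

lemma geronimus_mult_linear: "geronimus a M L ([:-a, 1:] * p) = L p"
proof -
  have "poly ([:-a, 1:] * p) a = 0"
    by simp
  moreover have "[:-a, 1:] * p div [:-a, 1:] = p"
    by (rule nonzero_mult_div_cancel_left) simp
  ultimately show ?thesis
    unfolding geronimus_def by (simp only: pCons_0_0 diff_zero mult_zero_right add_0_right)
qed

section \<open>Orthogonality and expansions in monic orthogonal polynomials\<close>

lemma monic_ops_degree: "monic_ops L P \<Longrightarrow> degree (P n) = n"
  and monic_ops_coeff: "monic_ops L P \<Longrightarrow> coeff (P n) n = 1"
  and monic_ops_sq: "monic_ops L P \<Longrightarrow> L (P n * P n) \<noteq> 0"
  and monic_ops_orth: "monic_ops L P \<Longrightarrow> n \<noteq> m \<Longrightarrow> L (P n * P m) = 0"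
  unfolding monic_ops_def power2_eq_square by (metis, metis, metis, metis)

text \<open>The zero alternative is kept apart because \<open>degree 0 = 0\<close>, so for
  \<open>n = 0\<close> no strict bound can hold.\<close>

lemma degree_diff_smult_monic:
  fixes p q :: "complex poly"
  assumes "degree p \<le> n" "degree q = n" "coeff q n = 1"
  shows "p - smult (coeff p n) q = 0 \<or> degree (p - smult (coeff p n) q) < n"
proof (rule disjCI)
  assume *: "\<not> degree (p - smult (coeff p n) q) < n"
  let ?r = "p - smult (coeff p n) q"
  have "degree ?r \<le> n"
    using assms by (intro degree_diff_le degree_smult_le[THEN order_trans]) auto
  with * have "lead_coeff ?r = coeff ?r n"
    by (simp add: le_antisym)
  also have "\<dots> = 0"
    using assms by simp
  finally show "?r = 0"
    by (simp only: leading_coeff_0_iff)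
qed

text \<open>Strong induction on the degree: removing the leading term of \<open>p\<close> with the
  \<open>P k\<close> of the same degree leaves a smaller remainder, and the removed part is
  orthogonal to \<open>P n\<close>.\<close>

lemma monic_ops_orth_lower:
  assumes L: "linear_functional L" and P: "monic_ops L P" and "degree p < n"
  shows "L (P n * p) = 0"
  using \<open>degree p < n\<close>
proof (induction "degree p" arbitrary: p rule: less_induct)
  case less
  let ?k = "degree p"
  let ?r = "p - smult (coeff p ?k) (P ?k)"
  have "?r = 0 \<or> degree ?r < ?k"
    by (rule degree_diff_smult_monic[OF order_refl monic_ops_degree[OF P] monic_ops_coeff[OF P]])
  then have "L (P n * ?r) = 0"
  proof
    assume "?r = 0"
    then show ?thesis
      by (simp only: mult_zero_right linear_functional_0[OF L])
  next
    assume "degree ?r < ?k"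
    then show ?thesis
      using less.prems by (intro less.hyps) simp_all
  qed
  moreover have "L (P n * ?r) = L (P n * p) - coeff p ?k * L (P n * P ?k)"
    by (simp only: right_diff_distrib mult_smult_right linear_functional_diff[OF L]
        linear_functional_smult[OF L])
  ultimately show ?case
    using monic_ops_orth[OF P, of n ?k] less.prems by simp
qed

lemma monic_ops_inner_top:
  assumes L: "linear_functional L" and P: "monic_ops L P" and "degree p \<le> n"
  shows "L (P n * p) = coeff p n * L (P n * P n)"
proof -
  let ?r = "p - smult (coeff p n) (P n)"
  have "?r = 0 \<or> degree ?r < n"
    by (rule degree_diff_smult_monic[OF assms(3) monic_ops_degree[OF P] monic_ops_coeff[OF P]])
  then have "L (P n * ?r) = 0"
  proof
    assume "?r = 0"
    then show ?thesis
      by (simp only: mult_zero_right linear_functional_0[OF L])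
  qed (rule monic_ops_orth_lower[OF L P])
  then show ?thesis
    by (simp add: right_diff_distrib linear_functional_diff[OF L] linear_functional_smult[OF L])
qed

text \<open>Testing against the \<open>P k\<close> of the same degree gives the leading coefficient
  of \<open>p\<close> times a nonzero norm. This serves to recognize vanishing remainders.\<close>

lemma monic_ops_nondegenerate:
  assumes L: "linear_functional L" and P: "monic_ops L P"
    and orth: "\<And>q. degree q \<le> degree p \<Longrightarrow> L (p * q) = 0"
  shows "p = 0"
proof -
  have "L (p * P (degree p)) = 0"
    by (rule orth) (simp add: monic_ops_degree[OF P])
  then have "lead_coeff p * L (P (degree p) * P (degree p)) = 0"
    using monic_ops_inner_top[OF L P order_refl, of p] by (simp only: mult.commute[of p])
  then show ?thesis
    using monic_ops_sq[OF P, of "degree p"] by (simp only: mult_eq_0_iff leading_coeff_0_iff) blast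
qed

text \<open>Peeling off the top two coefficients leaves a remainder of degree below \<open>n\<close>
  that is still orthogonal to all such polynomials, hence zero. The first coefficient is explicit
  because it must be known to be 1 in the Christoffel case.\<close>

lemma monic_ops_span_two:
  assumes L: "linear_functional L" and P: "monic_ops L P"
    and deg: "degree q \<le> Suc n" and orth: "\<And>p. degree p < n \<Longrightarrow> L (q * p) = 0"
  shows "\<exists>b. q = smult (coeff q (Suc n)) (P (Suc n)) + smult b (P n)"
proof -
  let ?r = "q - smult (coeff q (Suc n)) (P (Suc n))"
  let ?s = "?r - smult (coeff ?r n) (P n)"
  have "degree ?r \<le> n"
    using degree_diff_smult_monic[OF deg monic_ops_degree[OF P] monic_ops_coeff[OF P]]
    by (auto simp only: degree_0 less_Suc_eq_le)
  then have "?s = 0 \<or> degree ?s < n"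
    using degree_diff_smult_monic[OF _ monic_ops_degree[OF P] monic_ops_coeff[OF P]] by blast
  moreover have "?s = 0" if s: "degree ?s < n"
  proof (rule monic_ops_nondegenerate[OF L P])
    fix p :: "complex poly"
    assume "degree p \<le> degree ?s"
    then have "degree p < n" "degree p < Suc n"
      using s by simp_all
    then show "L (?s * p) = 0"
      by (simp add: left_diff_distrib linear_functional_diff[OF L] linear_functional_smult[OF L]
          orth monic_ops_orth_lower[OF L P])
  qed
  ultimately have "?s = 0"
    by blast
  then show ?thesis
    by (intro exI[of _ "coeff ?r n"]) (simp add: algebra_simps)
qed

section \<open>Expansions for the transformed families\<close>

lemma degree_linear_mult: "degree ([:a, 1:] * p) \<le> Suc (degree (p :: complex poly))"
  by (rule degree_mult_le[THEN order_trans]) simp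

text \<open>Inserting the factor \<open>x - a\<close> turns \<open>L\<close> into its Geronimus
  transform; this costs one degree in the test polynomial.\<close>

lemma geronimus_ops_orth:
  assumes L: "linear_functional L" and G: "monic_ops (geronimus a M L) G" and "Suc (degree p) < n"
  shows "L (G n * p) = 0"
proof -
  have "L (G n * p) = geronimus a M L (G n * ([:-a, 1:] * p))"
    unfolding geronimus_mult_linear[symmetric, of L "G n * p" a M] by (simp only: mult.left_commute)
  also have "\<dots> = 0"
    using degree_linear_mult[of "-a" p] assms(3)
    by (intro monic_ops_orth_lower[OF linear_functional_geronimus[OF L] G]) simp
  finally show ?thesis .
qed

text \<open>Moving the factor \<open>x - a\<close> onto \<open>C n\<close> makes orthogonality for
  the transform into orthogonality for \<open>L\<close>. Evaluation at \<open>a\<close> shows that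
  \<open>c\<close> is the constant in the kernel polynomial formula.\<close>

lemma christoffel_ops_expand:
  assumes L: "linear_functional L" and P: "monic_ops L P" and C: "monic_ops (christoffel a L) C"
  obtains c where "c \<noteq> 0" "[:-a, 1:] * C n = P (Suc n) + smult c (P n)"
proof -
  let ?q = "[:-a, 1:] * C n"
  have deg: "degree ?q \<le> Suc n"
    using degree_linear_mult[of "-a" "C n"] by (simp only: monic_ops_degree[OF C])
  have "coeff (C n) (Suc n) = 0"
    by (rule coeff_eq_0) (simp add: monic_ops_degree[OF C])
  then have top: "coeff ?q (Suc n) = 1"
    by (simp add: monic_ops_coeff[OF C])
  have "L (?q * p) = 0" if "degree p < n" for p
    using monic_ops_orth_lower[OF linear_functional_christoffel[OF L] C that]
    unfolding christoffel_def by (simp only: mult.assoc)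
  from monic_ops_span_two[OF L P deg this] obtain c where
    c: "?q = P (Suc n) + smult c (P n)"
    unfolding top by auto
  moreover have "c \<noteq> 0"
  proof
    assume "c = 0"
    then have "christoffel a L (C n * C n) = L (P (Suc n) * C n)"
      using c unfolding christoffel_def by (simp only: mult.assoc[symmetric] smult_0_left add_0_right)
    also have "\<dots> = 0"
      by (rule monic_ops_orth_lower[OF L P]) (simp add: monic_ops_degree[OF C])
    finally show False
      using monic_ops_sq[OF C] by blast
  qed
  ultimately show ?thesis
    using that by blast
qed

lemma degree_diff_quasi_geronimus:
  assumes P: "monic_ops L P" and G: "monic_ops L' G"
  shows "degree ([:0, 1:] * P n - quasi_geronimus \<beta> G (Suc n)) \<le> n"
proof (rule degree_le, intro allI impI)
  fix i
  assume "n < i"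
  then obtain k where i: "i = Suc k" and "n \<le> k"
    by (cases i) auto
  \<comment> \<open>For \<open>k = n\<close> both are leading coefficients 1, which cancel; beyond
    that both are 0.\<close>
  have "coeff (P n) k = coeff (G (Suc n)) (Suc k)"
    using \<open>n \<le> k\<close> monic_ops_degree[OF P, of n] monic_ops_degree[OF G, of "Suc n"]
      monic_ops_coeff[OF P, of n] monic_ops_coeff[OF G, of "Suc n"]
    by (cases "k = n") (simp_all add: coeff_eq_0)
  moreover have "coeff (G n) (Suc k) = 0"
    using \<open>n \<le> k\<close> monic_ops_degree[OF G, of n] by (simp add: coeff_eq_0)
  ultimately show "coeff ([:0, 1:] * P n - quasi_geronimus \<beta> G (Suc n)) i = 0"
    by (simp add: quasi_geronimus_def i)
qed

lemma diff_quasi_geronimus_expand: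
  assumes L: "linear_functional L" and P: "monic_ops L P" and G: "monic_ops (geronimus a M L) G"
  obtains b c where
    "[:0, 1:] * P (Suc n) - quasi_geronimus \<beta> G (Suc (Suc n)) = smult b (P (Suc n)) + smult c (P n)"
proof -
  let ?q = "[:0, 1:] * P (Suc n) - quasi_geronimus \<beta> G (Suc (Suc n))"
  have "L (?q * p) = 0" if p: "degree p < n" for p
  proof -
    \<comment> \<open>The factor \<open>x\<close> goes to the test polynomial, whose degree stays at
      most \<open>n\<close>.\<close>
    have "L (P (Suc n) * ([:0, 1:] * p)) = 0"
      using p degree_linear_mult[of 0 p] by (intro monic_ops_orth_lower[OF L P]) simp
    moreover have "?q * p = P (Suc n) * ([:0, 1:] * p)
        - (G (Suc (Suc n)) * p + smult (\<beta> (Suc (Suc n))) (G (Suc n) * p))"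
      by (simp add: quasi_geronimus_def algebra_simps)
    \<comment> \<open>The term with \<open>G (Suc n)\<close> is the binding one: it vanishes exactly
      for \<open>Suc (degree p) < Suc n\<close>.\<close>
    ultimately show ?thesis
      using p by (simp only: linear_functional_diff[OF L] linear_functional_add[OF L]
          linear_functional_smult[OF L]) (simp add: geronimus_ops_orth[OF L G])
  qed
  from monic_ops_span_two[OF L P degree_diff_quasi_geronimus[OF P G] this]
  show ?thesis
    using that by blast
qed

text \<open>This is the claim with the denominator cleared, for a single \<open>n\<close>.\<close>

lemma quasi_geronimus_relation:
  assumes L: "linear_functional L" and P: "monic_ops L P"
    and G: "monic_ops (geronimus a M L) G" and C: "monic_ops (christoffel a' L) C"
  shows "\<exists>\<gamma> \<eta>. [:-\<eta>, 1:] * P n =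
    quasi_geronimus \<beta> G (n + 1) + smult \<gamma> [:-a', 1:] * pred_term C n"
proof (cases n)
  case 0
  have "P 0 = 1"
    using monic_ops_degree[OF P, of 0] monic_ops_coeff[OF P, of 0]
    by (auto elim!: degree_eq_zeroE)
  \<comment> \<open>The difference is constant, and that constant is \<eta>; any \<gamma> works, as
    \<open>pred_term C 0 = 0\<close>.\<close>
  moreover have "degree ([:0, 1:] * P 0 - quasi_geronimus \<beta> G (Suc 0)) = 0"
    using degree_diff_quasi_geronimus[OF P G, of 0] by simp
  then obtain \<eta> where "[:0, 1:] * P 0 - quasi_geronimus \<beta> G (Suc 0) = [:\<eta>:]"
    by (rule degree_eq_zeroE)
  ultimately have "quasi_geronimus \<beta> G (Suc 0) = [:0, 1:] - [:\<eta>:]"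
    by (simp add: algebra_simps)
  then have "quasi_geronimus \<beta> G (Suc 0) = [:-\<eta>, 1:]"
    by simp
  with \<open>P 0 = 1\<close> 0 show ?thesis
    by (auto simp: pred_term_def)
next
  case (Suc m)
  obtain d where d: "d \<noteq> 0" "[:-a', 1:] * C m = P (Suc m) + smult d (P m)"
    by (rule christoffel_ops_expand[OF L P C])
  obtain b c where
    "[:0, 1:] * P (Suc m) - quasi_geronimus \<beta> G (Suc (Suc m)) = smult b (P (Suc m)) + smult c (P m)"
    by (rule diff_quasi_geronimus_expand[OF L P G])
  then have "[:0, 1:] * P (Suc m) =
      quasi_geronimus \<beta> G (Suc (Suc m)) + smult b (P (Suc m)) + smult c (P m)"
    by (simp add: algebra_simps)
  moreover have "[:-e, 1:] * p = [:0, 1:] * p - smult e p" for e and p :: "complex poly"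
    by simp
  \<comment> \<open>The choice \<gamma> = \<open>c / d\<close> matches the \<open>P m\<close>
    component. It also brings in \<open>c / d\<close> times \<open>P (Suc m)\<close>, whence \<eta>
    = \<open>b - c / d\<close>.\<close>
  moreover have "smult (c / d) [:-a', 1:] * C m = smult (c / d) (P (Suc m)) + smult c (P m)"
    using d unfolding mult_smult_left by (simp only: smult_add_right) simp
  ultimately have "[:-(b - c / d), 1:] * P (Suc m) =
      quasi_geronimus \<beta> G (Suc (Suc m)) + smult (c / d) [:-a', 1:] * C m"
    by (simp only: smult_diff_left) (simp only: algebra_simps)
  then show ?thesis
    unfolding Suc pred_term_def nat.case Suc_eq_plus1[symmetric] by blast
qed

theorem theorem3p4:
  fixes L :: "complex poly \<Rightarrow> complex"
    and P G C :: "nat \<Rightarrow> complex poly"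
    and a1 a2 :: real and M :: complex
    and \<beta> :: "nat \<Rightarrow> complex"
  assumes "linear_functional L"
    and "quasi_definite L" and "monic_ops L P"
    and "quasi_definite (geronimus (of_real a1) M L)"
    and "monic_ops (geronimus (of_real a1) M L) G"
    and "quasi_definite (christoffel (of_real a2) L)"
    and "monic_ops (christoffel (of_real a2) L) C"
  shows "\<exists>\<gamma> \<eta> :: nat \<Rightarrow> complex. \<forall>n.
           to_fract (P n) =
             Fract 1 [:- \<eta> n, 1:] * to_fract (quasi_geronimus \<beta> G (n + 1))
             + Fract (smult (\<gamma> n) [:- of_real a2, 1:]) [:- \<eta> n, 1:] * to_fract (pred_term C n)"
proof -
  have "\<forall>n. \<exists>\<gamma> \<eta>. [:-\<eta>, 1:] * P n =
      quasi_geronimus \<beta> G (n + 1) + smult \<gamma> [:- of_real a2, 1:] * pred_term C n"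
    using quasi_geronimus_relation[OF assms(1,3,5,7)] by blast
  then obtain \<gamma> \<eta> where *: "[:-\<eta> n, 1:] * P n =
      quasi_geronimus \<beta> G (n + 1) + smult (\<gamma> n) [:- of_real a2, 1:] * pred_term C n" for n
    by metis
  have "to_fract (P n) =
      Fract 1 [:- \<eta> n, 1:] * to_fract (quasi_geronimus \<beta> G (n + 1))
      + Fract (smult (\<gamma> n) [:- of_real a2, 1:]) [:- \<eta> n, 1:] * to_fract (pred_term C n)" for n
  proof -
    \<comment> \<open>Naming the linear factors keeps them opaque to simplification while the
      fractions are cleared; the denominator is monic, hence nonzero.\<close>
    define d where "d = [:- \<eta> n, 1:]"
    define l where "l = smult (\<gamma> n) [:- of_real a2, 1:]"
    have "d \<noteq> 0"
      by (simp add: d_def)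
    moreover have "d * P n = quasi_geronimus \<beta> G (n + 1) + l * pred_term C n"
      unfolding d_def l_def by (rule *)
    ultimately show ?thesis
      unfolding d_def[symmetric] l_def[symmetric] to_fract_def
      by (simp add: eq_fract algebra_simps)
  qed
  then show ?thesis
    by blast
qed

end
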